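(* Let $\mathcal{P}$ be a strongly regular U-poset and let $A=\{a_1,\dots,a_m\}$, $B=\{b_1,\dots,b_m\}$ ($m\ge1$) be subsets of $\mathcal{P}$ such that $a_i\le b_j$ if and only if $i=j$. Let $k_i=r(a_i)$, $l_i=r(b_i)$. Then $$\sum_{i=1}^m\beta(k_i,l_i)+\sum_{x\in\mathcal{U}(A)\setminus\mathcal{D}(B)}\frac{W_A(x)}{d^-_{r(x)}N_{r(x)}}=1,$$ where $$\beta(k_i,l_i)=\sum_{j=0}^{l_i-k_i}\frac{\lambda_{k_i+j}(k_i,l_i)}{d^-_{k_i+j}N_{k_i+j}}\left(d^-_{k_i+j}-\lambda_{k_i+j-1}(k_i,k_i+j)\right),$$ and, if $k_i=0$, the $j=0$ summand of $\beta(k_i,l_i)$ is interpreted as $1$.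
   Context: All posets are finite. A poset $\mathcal{P}$ is ranked with rank function $r$ if every minimal element has rank $0$ and $r(b)=r(a)+1$ whenever $b$ covers $a$; $\mathcal{P}_i$ is the set of elements of rank $i$ and $N_i=|\mathcal{P}_i|$. $\mathcal{P}$ is regular if for every element $a$ both the number of elements covering $a$ and the number of elements covered by $a$ depend only on $r(a)$; $d^-_i$ is the number of elements covered by an element of rank $i$ ($d^-_0=0$). A U-poset has a unique minimum and unique maximum. For $a\in\mathcal{P}$: $\Gamma^+_i(a)=\{x\in\mathcal{P}_i:x\ge a\}$, $\Gamma^-_i(a)=\{x\in\mathcal{P}_i:x\le a\}$, $\Gamma^-(x)=\Gamma^-_{r(x)-1}(x)$; for a set $S$, $\Gamma^+_i(S)=\bigcup_{s\in S}\Gamma^+_i(s)$. A U-poset is strongly regular if for all $a<b$ in $\mathcal{P}$ the number $|\Gamma^+_i(a)\cap\Gamma^-_i(b)|$ depends only on $i$, $r(a)$, $r(b)$; then $\lambda_i(k,l)$ denotes this number for $r(a)=k$, $r(b)=l$, $k\le i\le l$, and $\lambda_i(k,l)=0$ for all other integer triples. $\mathcal{U}(A)=\{x: x\ge a\text{ for some }a\in A\}$, $\mathcal{D}(B)=\{x:x\le b\text{ for some }b\in B\}$. $A^x=\{a\in A:a\le x\}$; $W_A(x)=0$ if $A^x=\emptyset$, else $W_A(x)=|\Gamma^-(x)\setminus\Gamma^+_{r(x)-1}(A^x)|$. *)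

theory Defs
  imports Complex_Main
begin

text \<open>
  A finite poset is a type of class \<open>{finite, order}\<close>; a finite poset with a unique minimum and a
  unique maximum is a type of class \<open>{finite, order_bot, order_top}\<close>. Rank functions take values
  in the integers, so that level indices such as \<open>r x - 1\<close> are never truncated.
\<close>

definition covers :: "'a::order \<Rightarrow> 'a \<Rightarrow> bool" where
  "covers b a \<longleftrightarrow> a < b \<and> \<not> (\<exists>c. a < c \<and> c < b)"

definition rank_function :: "('a::order \<Rightarrow> int) \<Rightarrow> bool" where
  "rank_function r \<longleftrightarrow>
     (\<forall>x. \<not> (\<exists>y. y < x) \<longrightarrow> r x = 0) \<and> (\<forall>a b. covers b a \<longrightarrow> r b = r a + 1)"

definition level_size :: "('a \<Rightarrow> int) \<Rightarrow> int \<Rightarrow> nat" where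
  "level_size r i = card {x. r x = i}"

definition up_level :: "('a::order \<Rightarrow> int) \<Rightarrow> int \<Rightarrow> 'a \<Rightarrow> 'a set" where
  "up_level r i a = {x. r x = i \<and> a \<le> x}"

definition down_level :: "('a::order \<Rightarrow> int) \<Rightarrow> int \<Rightarrow> 'a \<Rightarrow> 'a set" where
  "down_level r i a = {x. r x = i \<and> x \<le> a}"

definition strongly_regular :: "('a::order \<Rightarrow> int) \<Rightarrow> bool" where
  "strongly_regular r \<longleftrightarrow>
     (\<forall>i a b a' b'. a < b \<and> a' < b' \<and> r a = r a' \<and> r b = r b' \<longrightarrow>
        card (up_level r i a \<inter> down_level r i b) = card (up_level r i a' \<inter> down_level r i b'))"

text \<open>
  The common number of elements covered by the elements of rank \<open>i\<close>; a junk value if there is no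
  such number or no element of rank \<open>i\<close>. For rank functions of strongly regular posets with least
  and greatest element see \<open>down_degree_eq\<close> below.
\<close>

definition down_degree :: "('a::order \<Rightarrow> int) \<Rightarrow> int \<Rightarrow> nat" where
  "down_degree r i = (THE d. \<exists>x. r x = i \<and> d = card {y. covers x y})"

text \<open>
  The pair \<open>a \<le> b\<close> need not be strict, so that the value at \<open>i = k = l\<close> is \<open>1\<close> if rank \<open>k\<close> occurs.
\<close>

definition interval_level :: "('a::order \<Rightarrow> int) \<Rightarrow> int \<Rightarrow> int \<Rightarrow> int \<Rightarrow> nat" where
  "interval_level r i k l =
     (if k \<le> i \<and> i \<le> l \<and> (\<exists>a b. a \<le> b \<and> r a = k \<and> r b = l)
      then THE n. \<exists>a b. a \<le> b \<and> r a = k \<and> r b = l \<and>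
                        n = card (up_level r i a \<inter> down_level r i b)
      else 0)"

definition up_set :: "'a::order set \<Rightarrow> 'a set" where
  "up_set A = {x. \<exists>a\<in>A. a \<le> x}"

definition down_set :: "'a::order set \<Rightarrow> 'a set" where
  "down_set B = {x. \<exists>b\<in>B. x \<le> b}"

definition below :: "'a::order set \<Rightarrow> 'a \<Rightarrow> 'a set" where
  "below A x = {a \<in> A. a \<le> x}"

definition weight :: "('a::order \<Rightarrow> int) \<Rightarrow> 'a set \<Rightarrow> 'a \<Rightarrow> nat" where
  "weight r A x =
     (if below A x = {} then 0
      else card (down_level r (r x - 1) x - (\<Union>a\<in>below A x. up_level r (r x - 1) a)))"

definition beta :: "('a::order \<Rightarrow> int) \<Rightarrow> int \<Rightarrow> int \<Rightarrow> real" where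
  "beta r k l =
     (\<Sum>j = 0..l - k.
        if k = 0 \<and> j = 0 then 1
        else real (interval_level r (k + j) k l)
               / (real (down_degree r (k + j)) * real (level_size r (k + j)))
             * (real (down_degree r (k + j)) - real (interval_level r (k + j - 1) k (k + j))))"

lemma rank_strict_mono:
  fixes r :: "'a::{finite, order} \<Rightarrow> int"
  assumes "rank_function r" and "a < b"
  shows "r a < r b"
  using assms(2)
proof (induction "card {x. a < x \<and> x < b}" arbitrary: a b rule: less_induct)
  case less
  show ?case
  proof (cases "covers b a")
    case True
    then show ?thesis using assms(1) by (simp add: rank_function_def)
  next
    case False
    then obtain c where c: "a < c" "c < b" using less.prems by (auto simp: covers_def)
    have "{x. a < x \<and> x < c} \<subset> {x. a < x \<and> x < b}"
      "{x. c < x \<and> x < b} \<subset> {x. a < x \<and> x < b}"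
      using c by (auto dest: less_trans)
    then have "r a < r c" "r c < r b"
      using c less.hyps by (meson finite psubset_card_mono)+
    then show ?thesis by simp
  qed
qed

lemma interval_level_eq:
  fixes r :: "'a::{finite, order} \<Rightarrow> int"
  assumes "rank_function r" and "strongly_regular r" and "a \<le> b" and "r a \<le> i" and "i \<le> r b"
  shows "interval_level r i (r a) (r b) = card (up_level r i a \<inter> down_level r i b)"
proof -
  have eq: "card (up_level r i a' \<inter> down_level r i b') = card (up_level r i a \<inter> down_level r i b)"
    if "a' \<le> b'" "r a' = r a" "r b' = r b" for a' b'
  proof (cases "r a = r b")
    case True
    have "up_level r i x \<inter> down_level r i x = {x}" if "r x = i" for x
      using that by (auto simp: up_level_def down_level_def)
    moreover have "a = b" "a' = b'" "r a = i" "r a' = i"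
      using True that assms rank_strict_mono[OF assms(1)] by (force simp: order.order_iff_strict)+
    ultimately show ?thesis by simp
  next
    case False
    then have "a < b" "a' < b'" using that assms(3) by (auto simp: order.order_iff_strict)
    then show ?thesis using assms(2) that unfolding strongly_regular_def by metis
  qed
  have "(THE n. \<exists>a' b'. a' \<le> b' \<and> r a' = r a \<and> r b' = r b \<and>
           n = card (up_level r i a' \<inter> down_level r i b'))
        = card (up_level r i a \<inter> down_level r i b)"
    using assms(3) eq by (intro the_equality) blast+
  then show ?thesis using assms(3-5) by (auto simp: interval_level_def)
qed

lemma covers_iff_rank:
  fixes r :: "'a::{finite, order} \<Rightarrow> int"
  assumes "rank_function r"
  shows "covers x y \<longleftrightarrow> y \<le> x \<and> r y = r x - 1"
proof
  assume "covers x y"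
  then show "y \<le> x \<and> r y = r x - 1"
    using assms by (auto simp: rank_function_def covers_def)
next
  assume *: "y \<le> x \<and> r y = r x - 1"
  then have "y < x" by (auto simp: order.order_iff_strict)
  moreover have False if "y < c" "c < x" for c
    using * rank_strict_mono[OF assms that(1)] rank_strict_mono[OF assms that(2)] by simp
  ultimately show "covers x y" by (auto simp: covers_def)
qed

lemma down_degree_eq:
  fixes r :: "'a::{finite, order_bot, order_top} \<Rightarrow> int"
  assumes "rank_function r" and "strongly_regular r"
  shows "down_degree r (r x) = card {y. covers x y}"
proof -
  have cov: "{y. covers z y} = up_level r (r z - 1) bot \<inter> down_level r (r z - 1) z" for z
    using covers_iff_rank[OF assms(1)] by (auto simp: up_level_def down_level_def)
  have eq: "card {y. covers x' y} = card {y. covers x y}" if "r x' = r x" for x'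
  proof (cases "x = bot \<or> x' = bot")
    case True
    then have "x' = x" using that rank_strict_mono[OF assms(1)]
      by (metis bot.not_eq_extremum less_irrefl)
    then show ?thesis by simp
  next
    case False
    then have "bot < x" "bot < x'" by (simp_all add: bot.not_eq_extremum)
    then show ?thesis using assms(2) that unfolding cov strongly_regular_def by metis
  qed
  show ?thesis unfolding down_degree_def using eq by (intro the_equality) blast+
qed

end

theory Submission
  imports Defs
begin

text \<open>
  Every level of the poset is traversed by a unit flow: each element of rank \<open>i\<close> carries
  \<open>1 / N\<^sub>i\<close> and each covering edge below it carries \<open>1 / (d\<^sub>i N\<^sub>i)\<close>. For an up-closed set \<open>U\<close>, the flow
  on the edges that enter \<open>U\<close> between the levels \<open>i\<close> and \<open>i + 1\<close> is therefore the difference of the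
  densities of \<open>U\<close> in these levels, so that the total flow into \<open>U\<close> telescopes to \<open>1\<close>, or to \<open>0\<close> if
  \<open>U\<close> contains the minimum. With \<open>U = \<U>(A)\<close> the flow entering at \<open>x\<close> is \<open>W\<^sub>A(x) / (d N)\<close>, and
  \<open>\<U>(A) \<inter> \<D>(B)\<close> is the disjoint union of the intervals \<open>[a\<^sub>i, b\<^sub>i]\<close>, on which only \<open>a\<^sub>i\<close> matters.
\<close>

section \<open>Covers and ranks in a finite bounded poset\<close>

lemma exists_upper_cover:
  fixes x y :: "'a::{finite, order}"
  assumes "x < y"
  shows "\<exists>z. covers z x"
proof -
  obtain z where "z \<in> {z. x < z}" "\<forall>w\<in>{z. x < z}. w \<le> z \<longrightarrow> z = w"
    using finite_has_minimal[of "{z. x < z}"] assms by auto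
  then have "covers z x"
    by (auto simp: covers_def dest: order.strict_implies_order)
  then show ?thesis by blast
qed

lemma rank_bot:
  fixes r :: "'a::{finite, order_bot} \<Rightarrow> int"
  assumes "rank_function r"
  shows "r bot = 0"
  using assms by (simp add: rank_function_def)

lemma rank_eq_0_iff:
  fixes r :: "'a::{finite, order_bot} \<Rightarrow> int"
  assumes "rank_function r"
  shows "r x = 0 \<longleftrightarrow> x = bot"
  using rank_bot[OF assms] rank_strict_mono[OF assms, of bot x]
  by (cases "x = bot") (auto simp: bot.not_eq_extremum)

lemma rank_nonneg:
  fixes r :: "'a::{finite, order_bot} \<Rightarrow> int"
  assumes "rank_function r"
  shows "0 \<le> r x"
  using rank_bot[OF assms] rank_strict_mono[OF assms, of bot x]
  by (cases "x = bot") (auto simp: bot.not_eq_extremum)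

lemma rank_mono:
  fixes r :: "'a::{finite, order} \<Rightarrow> int"
  assumes "rank_function r" and "x \<le> y"
  shows "r x \<le> r y"
  using rank_strict_mono[OF assms(1), of x y] assms(2) by (auto simp: order.order_iff_strict)

text \<open>A cover raises the rank by exactly one, so climbing from \<open>bot\<close> along covers
  skips no level before \<open>top\<close> is reached. Nonempty levels give the densities nonzero
  denominators.\<close>

lemma exists_rank:
  fixes r :: "'a::{finite, order_bot, order_top} \<Rightarrow> int"
  assumes "rank_function r" and "int n \<le> r top"
  shows "\<exists>x. r x = int n"
  using assms(2)
proof (induction n)
  case 0
  then show ?case using rank_bot[OF assms(1)] by auto
next
  case (Suc n)
  then obtain x where x: "r x = int n" by auto
  then have "x < top" using Suc.prems by (auto simp: top.not_eq_extremum[symmetric])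
  then obtain z where "covers z x" using exists_upper_cover by blast
  then have "r z = int (Suc n)" using assms(1) x by (auto simp: rank_function_def)
  then show ?case by blast
qed

section \<open>Flow across levels into up-closed sets\<close>

text \<open>The covers of \<open>y\<close> form one level of the interval from \<open>y\<close> to
  \<open>top\<close>, so strong regularity applies with upper end \<open>top\<close>. It speaks of
  strict pairs only, but \<open>top\<close> is alone in its rank.\<close>

lemma up_degree_const:
  fixes r :: "'a::{finite, order_top} \<Rightarrow> int"
  assumes "rank_function r" and "strongly_regular r" and "r x = r x'"
  shows "card {z. covers z x} = card {z. covers z x'}"
proof -
  have cov: "{z. covers z y} = up_level r (r y + 1) y \<inter> down_level r (r y + 1) top" for y
    using covers_iff_rank[OF assms(1)] by (auto simp: up_level_def down_level_def)
  show ?thesis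
  proof (cases "x = top \<or> x' = top")
    case True
    then have "x' = x" using assms(3) rank_strict_mono[OF assms(1)]
      by (metis top.not_eq_extremum less_irrefl)
    then show ?thesis by simp
  next
    case False
    then have "x < top" "x' < top" by (simp_all add: top.not_eq_extremum)
    then show ?thesis using assms(2,3) unfolding cov strongly_regular_def by metis
  qed
qed

text \<open>Both sides count the covering edges inside \<open>U\<close> between two consecutive levels.\<close>

lemma sum_covers_up_closed:
  fixes r :: "'a::{finite, order} \<Rightarrow> int"
  assumes "rank_function r" and up: "\<forall>x\<in>U. \<forall>y\<ge>x. y \<in> U"
    and e: "\<forall>y. r y = i \<longrightarrow> card {x. covers x y} = e"
  shows "(\<Sum>x | x \<in> U \<and> r x = i + 1. card {y. covers x y \<and> y \<in> U})
       = card {y \<in> U. r y = i} * e"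
proof -
  have "(\<Sum>x | x \<in> U \<and> r x = i + 1. card {y. covers x y \<and> y \<in> U})
      = (\<Sum>x | x \<in> U \<and> r x = i + 1. card {y \<in> {y \<in> U. r y = i}. covers x y})"
    by (rule sum.cong[OF refl], rule arg_cong[where f = card])
      (auto simp: covers_iff_rank[OF assms(1)])
  also have "\<dots> = (\<Sum>y \<in> {y \<in> U. r y = i}. e)"
  proof (rule sum_multicount_gen)
    show "\<forall>y\<in>{y \<in> U. r y = i}. card {x \<in> {x. x \<in> U \<and> r x = i + 1}. covers x y} = e"
    proof
      fix y assume y: "y \<in> {y \<in> U. r y = i}"
      then have "{x \<in> {x. x \<in> U \<and> r x = i + 1}. covers x y} = {x. covers x y}"
        using up by (auto simp: covers_iff_rank[OF assms(1)])
      then show "card {x \<in> {x. x \<in> U \<and> r x = i + 1}. covers x y} = e" using e y by simp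
    qed
  qed simp_all
  finally show ?thesis by simp
qed

text \<open>Of the edges going down from level \<open>n + 1\<close> of \<open>U\<close>, those that
  stay in \<open>U\<close> are all the upward edges from level \<open>n\<close> of \<open>U\<close>.
  Subtracting them and normalising by the number of edges between the two full levels gives the
  difference of densities.\<close>

lemma flow_into_up_closed_level:
  fixes r :: "'a::{finite, order_bot, order_top} \<Rightarrow> int"
  assumes r: "rank_function r" and sr: "strongly_regular r"
    and up: "\<forall>x\<in>U. \<forall>y\<ge>x. y \<in> U"
    and n: "int n + 1 \<le> r top"
  shows "(\<Sum>x | x \<in> U \<and> r x = int n + 1. real (card {y. covers x y \<and> y \<notin> U})
            / (real (down_degree r (int n + 1)) * real (level_size r (int n + 1))))
       = real (card {x \<in> U. r x = int n + 1}) / real (level_size r (int n + 1))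
         - real (card {x \<in> U. r x = int n}) / real (level_size r (int n))"
proof -
  define i where "i = int n"
  define d where "d = down_degree r (i + 1)"
  obtain y0 where y0: "r y0 = i" using exists_rank[OF r, of n] n by (auto simp: i_def)
  define e where "e = card {x. covers x y0}"
  have e: "\<forall>y. r y = i \<longrightarrow> card {x. covers x y} = e"
    using up_degree_const[OF r sr] y0 by (simp add: e_def)
  have d: "card {y. covers x y} = d" if "r x = i + 1" for x
    using down_degree_eq[OF r sr, of x] that by (simp add: d_def)
  \<comment> \<open>An actual edge between the two levels makes \<open>d\<close> and both level
    sizes positive.\<close>
  have "y0 < top" using y0 n by (auto simp: i_def top.not_eq_extremum[symmetric])
  then obtain x0 where x0: "covers x0 y0" using exists_upper_cover by blast
  then have rx0: "r x0 = i + 1" using covers_iff_rank[OF r] y0 by auto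
  have "{y. covers x0 y} \<noteq> {}" using x0 by blast
  then have d0: "d > 0" using d[OF rx0] by (metis card_gt_0_iff finite)
  have N0: "level_size r i > 0" "level_size r (i + 1) > 0"
    using y0 rx0 by (auto simp: level_size_def card_gt_0_iff)
  \<comment> \<open>With \<open>U = UNIV\<close> the double count gives all edges between the two
    levels, once from above and once from below.\<close>
  have N: "level_size r (i + 1) * d = level_size r i * e"
    using sum_covers_up_closed[OF r _ e, where U = UNIV] d by (simp add: level_size_def)
  have split: "card {y. covers x y \<and> y \<notin> U} + card {y. covers x y \<and> y \<in> U} = d"
    if "r x = i + 1" for x
  proof -
    have "{y. covers x y} = {y. covers x y \<and> y \<notin> U} \<union> {y. covers x y \<and> y \<in> U}" by blast
    then show ?thesis using d[OF that] by (metis (no_types, lifting) card_Un_disjoint disjoint_iff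
        finite mem_Collect_eq)
  qed
  have "(\<Sum>x | x \<in> U \<and> r x = i + 1. card {y. covers x y \<and> y \<notin> U})
      + card {y \<in> U. r y = i} * e
      = (\<Sum>x | x \<in> U \<and> r x = i + 1. card {y. covers x y \<and> y \<notin> U} + card {y. covers x y \<and> y \<in> U})"
    unfolding sum.distrib sum_covers_up_closed[OF r up e] ..
  also have "\<dots> = card {x \<in> U. r x = i + 1} * d"
    using split by simp
  finally have "(\<Sum>x | x \<in> U \<and> r x = i + 1. card {y. covers x y \<and> y \<notin> U})
      + card {y \<in> U. r y = i} * e = card {x \<in> U. r x = i + 1} * d" .
  then have "real (\<Sum>x | x \<in> U \<and> r x = i + 1. card {y. covers x y \<and> y \<notin> U})
      + real (card {y \<in> U. r y = i}) * real e = real (card {x \<in> U. r x = i + 1}) * real d"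
    by (simp only: of_nat_add[symmetric] of_nat_mult[symmetric])
  then have S: "(\<Sum>x | x \<in> U \<and> r x = i + 1. real (card {y. covers x y \<and> y \<notin> U}))
      = real (card {x \<in> U. r x = i + 1}) * real d - real (card {y \<in> U. r y = i}) * real e"
    by simp
  \<comment> \<open>The common denominator is rewritten for the second term only, so that
    \<open>d\<close> cancels in the first and \<open>e\<close> in the second.\<close>
  have N': "real d * real (level_size r (i + 1)) = real e * real (level_size r i)"
    using N by (metis mult.commute of_nat_mult)
  have e0: "e > 0" using N N0 d0 by (metis gr0I mult_is_0 less_irrefl)
  have "(\<Sum>x | x \<in> U \<and> r x = i + 1. real (card {y. covers x y \<and> y \<notin> U})
            / (real d * real (level_size r (i + 1))))
      = real (card {x \<in> U. r x = i + 1}) * real d / (real d * real (level_size r (i + 1)))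
        - real (card {y \<in> U. r y = i}) * real e / (real e * real (level_size r i))"
    unfolding N'[symmetric] diff_divide_distrib[symmetric] S[symmetric] sum_divide_distrib ..
  also have "\<dots> = real (card {x \<in> U. r x = i + 1}) / real (level_size r (i + 1))
        - real (card {y \<in> U. r y = i}) / real (level_size r i)"
    using d0 e0 by simp
  finally show ?thesis by (simp add: i_def d_def)
qed

text \<open>The level differences telescope. The extreme levels are the singletons of
  \<open>top\<close> and \<open>bot\<close>, so the final density is 1 and the initial one is the
  indicator of \<open>bot\<close>.\<close>

lemma flow_into_up_closed:
  fixes r :: "'a::{finite, order_bot, order_top} \<Rightarrow> int"
  assumes r: "rank_function r" and sr: "strongly_regular r"
    and up: "\<forall>x\<in>U. \<forall>y\<ge>x. y \<in> U" and "top \<in> U"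
  shows "(\<Sum>x\<in>U. real (card {y. covers x y \<and> y \<notin> U})
            / (real (down_degree r (r x)) * real (level_size r (r x))))
       = 1 - of_bool (bot \<in> U)"
proof -
  let ?f = "\<lambda>x. real (card {y. covers x y \<and> y \<notin> U})
              / (real (down_degree r (r x)) * real (level_size r (r x)))"
  let ?u = "\<lambda>i. real (card {x \<in> U. r x = i}) / real (level_size r i)"
  have partial: "(\<Sum>x | x \<in> U \<and> r x \<le> int n. ?f x) = ?u (int n) - ?u 0"
    if "int n \<le> r top" for n
    using that
  proof (induction n)
    case 0
    have "?f x = 0" if "r x \<le> 0" for x
    proof -
      have "x = bot" using that rank_nonneg[OF r, of x] rank_eq_0_iff[OF r] by auto
      then have "{y. covers x y \<and> y \<notin> U} = {}" by (simp add: covers_def)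
      then show ?thesis by simp
    qed
    then have "(\<Sum>x | x \<in> U \<and> r x \<le> 0. ?f x) = 0" by (intro sum.neutral) blast
    then show ?case by simp
  next
    case (Suc n)
    have "{x. x \<in> U \<and> r x \<le> int (Suc n)}
        = {x. x \<in> U \<and> r x \<le> int n} \<union> {x. x \<in> U \<and> r x = int n + 1}" by auto
    then have "(\<Sum>x | x \<in> U \<and> r x \<le> int (Suc n). ?f x)
        = (\<Sum>x | x \<in> U \<and> r x \<le> int n. ?f x) + (\<Sum>x | x \<in> U \<and> r x = int n + 1. ?f x)"
      by (simp only:) (rule sum.union_disjoint, auto)
    also have "(\<Sum>x | x \<in> U \<and> r x = int n + 1. ?f x) = ?u (int n + 1) - ?u (int n)"
      using flow_into_up_closed_level[OF r sr up] Suc.prems by simp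
    finally show ?case using Suc by (simp add: add.commute)
  qed
  have "{x. x \<in> U \<and> r x \<le> r top} = U" using rank_mono[OF r top_greatest] by auto
  then have "sum ?f U = ?u (r top) - ?u 0"
    using partial[of "nat (r top)"] rank_nonneg[OF r, of top] by simp
  moreover have "r x = r top \<longleftrightarrow> x = top" for x
    using rank_strict_mono[OF r] by (metis less_irrefl top.not_eq_extremum)
  then have "?u (r top) = 1"
    using \<open>top \<in> U\<close> by (simp add: level_size_def Collect_conv_if conj_commute)
  moreover have "?u 0 = of_bool (bot \<in> U)"
  proof -
    have "{x \<in> U. x = bot} = (if bot \<in> U then {bot} else {})" by auto
    then show ?thesis using rank_eq_0_iff[OF r] by (simp add: level_size_def)
  qed
  ultimately show ?thesis by simp
qed

text \<open>An element of \<open>A\<close> below some \<open>y\<close> covered by \<open>x\<close>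
  is also below \<open>x\<close>, so restricting to \<open>below A x\<close> loses nothing: the
  weight counts the edges entering \<open>up_set A\<close> at \<open>x\<close>.\<close>

lemma weight_eq_card_covers:
  fixes r :: "'a::{finite, order} \<Rightarrow> int"
  assumes "rank_function r" and "x \<in> up_set A"
  shows "weight r A x = card {y. covers x y \<and> y \<notin> up_set A}"
proof -
  have "down_level r (r x - 1) x - (\<Union>a\<in>below A x. up_level r (r x - 1) a)
      = {y. covers x y \<and> y \<notin> up_set A}"
    by (auto simp: covers_iff_rank[OF assms(1)] down_level_def up_level_def up_set_def below_def
        intro: order_trans)
  moreover have "below A x \<noteq> {}" using assms(2) by (auto simp: below_def up_set_def)
  ultimately show ?thesis by (simp add: weight_def)
qed

text \<open>
  If \<open>r a = 0\<close>, the left-hand side has the junk summand \<open>0\<close> at \<open>x = a\<close>, as \<open>down_degree r 0 = 0\<close>;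
  \<open>beta\<close> has \<open>1\<close> in its place.
\<close>

lemma sum_interval_eq_beta:
  fixes r :: "'a::{finite, order_bot, order_top} \<Rightarrow> int"
  assumes r: "rank_function r" and sr: "strongly_regular r" and "a \<le> b"
  shows "(\<Sum>x\<in>{a..b}. real (card {y. covers x y \<and> \<not> a \<le> y})
            / (real (down_degree r (r x)) * real (level_size r (r x))))
       = beta r (r a) (r b) - of_bool (r a = 0)"
proof -
  define k where "k = r a"
  define l where "l = r b"
  \<comment> \<open>The flow entering the up-set of \<open>a\<close> at an element of rank
    \<open>i\<close> above \<open>a\<close>. It depends on the rank alone, so the interval can be
    summed by levels.\<close>
  define g where "g i = (real (down_degree r i) - real (interval_level r (i - 1) k i))
                        / (real (down_degree r i) * real (level_size r i))" for i
  have kl: "k \<le> l" using rank_mono[OF r \<open>a \<le> b\<close>] by (simp add: k_def l_def)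
  have W: "real (card {y. covers x y \<and> \<not> a \<le> y})
         = real (down_degree r (r x)) - real (interval_level r (r x - 1) k (r x))"
    if "a \<le> x" for x
  proof -
    have "card {y. covers x y \<and> a \<le> y} = interval_level r (r x - 1) k (r x)"
    proof (cases "k \<le> r x - 1")
      case True
      have "{y. covers x y \<and> a \<le> y} = up_level r (r x - 1) a \<inter> down_level r (r x - 1) x"
        by (auto simp: covers_iff_rank[OF r] up_level_def down_level_def)
      then show ?thesis
        using interval_level_eq[OF r sr that, of "r x - 1"] True by (simp add: k_def)
    next
      \<comment> \<open>This is the case \<open>x = a\<close>, where \<open>interval_level\<close>
        has its default value 0 because its level index is below \<open>k\<close>.\<close>
      case False
      have "{y. covers x y \<and> a \<le> y} = {}"
        using False rank_mono[OF r] by (force simp: covers_iff_rank[OF r] k_def)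
      then show ?thesis using False by (simp add: interval_level_def)
    qed
    moreover have "{y. covers x y} = {y. covers x y \<and> \<not> a \<le> y} \<union> {y. covers x y \<and> a \<le> y}"
      by blast
    then have "card {y. covers x y}
        = card {y. covers x y \<and> \<not> a \<le> y} + card {y. covers x y \<and> a \<le> y}"
      by (metis (no_types, lifting) card_Un_disjoint disjoint_iff finite mem_Collect_eq)
    ultimately show ?thesis using down_degree_eq[OF r sr, of x] by simp
  qed
  have "(\<Sum>x\<in>{a..b}. real (card {y. covers x y \<and> \<not> a \<le> y})
            / (real (down_degree r (r x)) * real (level_size r (r x))))
      = (\<Sum>x\<in>{a..b}. g (r x))"
    by (rule sum.cong) (simp_all add: W g_def)
  also have "\<dots> = (\<Sum>i\<in>{k..l}. \<Sum>x\<in>{x \<in> {a..b}. r x = i}. g (r x))"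
    by (rule sum.group[symmetric]) (auto simp: k_def l_def rank_mono[OF r])
  also have "\<dots> = (\<Sum>i\<in>{k..l}. real (interval_level r i k l) * g i)"
  proof (rule sum.cong[OF refl])
    fix i assume i: "i \<in> {k..l}"
    have "{x \<in> {a..b}. r x = i} = up_level r i a \<inter> down_level r i b"
      by (auto simp: up_level_def down_level_def)
    then have "card {x \<in> {a..b}. r x = i} = interval_level r i k l"
      using interval_level_eq[OF r sr \<open>a \<le> b\<close>, of i] i by (simp add: k_def l_def)
    then show "(\<Sum>x\<in>{x \<in> {a..b}. r x = i}. g (r x)) = real (interval_level r i k l) * g i"
      by simp
  qed
  also have "\<dots> = (\<Sum>j\<in>{0..l - k}. real (interval_level r (k + j) k l) * g (k + j))"
    by (rule sum.reindex_bij_witness[of _ "\<lambda>j. k + j" "\<lambda>i. i - k"]) auto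
  also have "\<dots> = (\<Sum>j\<in>{0..l - k}. (if k = 0 \<and> j = 0 then 1
        else real (interval_level r (k + j) k l)
               / (real (down_degree r (k + j)) * real (level_size r (k + j)))
             * (real (down_degree r (k + j)) - real (interval_level r (k + j - 1) k (k + j))))
        - of_bool (k = 0 \<and> j = 0))"
  proof (rule sum.cong[OF refl])
    fix j
    have "{y. covers bot y} = ({} :: 'a set)" by (auto simp: covers_def)
    then have "down_degree r 0 = 0"
      using down_degree_eq[OF r sr, of bot] rank_bot[OF r] by simp
    then show "real (interval_level r (k + j) k l) * g (k + j) = (if k = 0 \<and> j = 0 then 1
        else real (interval_level r (k + j) k l)
               / (real (down_degree r (k + j)) * real (level_size r (k + j)))
             * (real (down_degree r (k + j)) - real (interval_level r (k + j - 1) k (k + j))))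
        - of_bool (k = 0 \<and> j = 0)"
      by (simp add: g_def)
  qed
  also have "\<dots> = beta r k l - (\<Sum>j\<in>{0..l - k}. of_bool (k = 0 \<and> j = 0))"
    by (simp only: sum_subtractf beta_def)
  also have "(\<Sum>j\<in>{0..l - k}. of_bool (k = 0 \<and> j = 0)) = (of_bool (k = 0) :: real)"
  proof -
    have "(\<Sum>j\<in>{0..l - k}. of_bool (k = 0 \<and> j = 0))
        = (\<Sum>j\<in>{0..l - k}. if j = 0 then of_bool (k = 0) else (0 :: real))"
      by (rule sum.cong) auto
    also have "\<dots> = of_bool (k = 0)" using kl by (subst sum.delta) auto
    finally show ?thesis .
  qed
  finally show ?thesis by (simp add: k_def l_def)
qed

section \<open>Splitting the flow into \<open>up_set A\<close> along
  \<open>down_set B\<close>\<close>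

theorem theorem2:
  fixes r :: "'a::{finite, order_bot, order_top} \<Rightarrow> int"
    and a b :: "nat \<Rightarrow> 'a"
    and m :: nat
    and A B :: "'a set"
  assumes "rank_function r"
    and "strongly_regular r"
    and "m \<ge> 1"
    and "A = a ` {1..m}"
    and "B = b ` {1..m}"
    and "\<forall>i\<in>{1..m}. \<forall>j\<in>{1..m}. a i \<le> b j \<longleftrightarrow> i = j"
  shows "(\<Sum>i = 1..m. beta r (r (a i)) (r (b i)))
       + (\<Sum>x \<in> up_set A - down_set B.
            real (weight r A x) / (real (down_degree r (r x)) * real (level_size r (r x)))) = 1"
proof -
  note r = assms(1) and sr = assms(2)
  let ?U = "up_set A"
  let ?f = "\<lambda>x. real (weight r A x) / (real (down_degree r (r x)) * real (level_size r (r x)))"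
  \<comment> \<open>No element lies both above \<open>a i\<close> and below \<open>b j\<close> for
    distinct indices. This yields the disjointness of the intervals and the local form of the
    weight.\<close>
  have ab: "i = j" if "a i \<le> x" "x \<le> b j" "i \<in> {1..m}" "j \<in> {1..m}" for i j x
    using assms(6) that order_trans by blast
  have le: "a i \<le> b i" if "i \<in> {1..m}" for i using assms(6) that by blast
  have "sum ?f ?U = (\<Sum>x\<in>?U. real (card {y. covers x y \<and> y \<notin> ?U})
            / (real (down_degree r (r x)) * real (level_size r (r x))))"
    by (rule sum.cong) (simp_all add: weight_eq_card_covers[OF r])
  also have "\<dots> = 1 - of_bool (bot \<in> ?U)"
  proof (rule flow_into_up_closed[OF r sr])
    show "\<forall>x\<in>?U. \<forall>y\<ge>x. y \<in> ?U"
      by (auto simp: up_set_def intro: order_trans)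
    show "top \<in> ?U" using assms(3,4) by (auto simp: up_set_def)
  qed
  finally have total: "sum ?f ?U = 1 - of_bool (bot \<in> ?U)" .
  have "?U \<inter> down_set B = (\<Union>i\<in>{1..m}. {a i..b i})"
  proof
    show "?U \<inter> down_set B \<subseteq> (\<Union>i\<in>{1..m}. {a i..b i})"
    proof
      fix x assume "x \<in> ?U \<inter> down_set B"
      then obtain i j where ij: "i \<in> {1..m}" "j \<in> {1..m}" "a i \<le> x" "x \<le> b j"
        unfolding assms(4,5) up_set_def down_set_def by blast
      then have "x \<in> {a i..b i}" using ab[of i x j] by simp
      then show "x \<in> (\<Union>i\<in>{1..m}. {a i..b i})" using ij(1) by blast
    qed
    show "(\<Union>i\<in>{1..m}. {a i..b i}) \<subseteq> ?U \<inter> down_set B"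
      unfolding assms(4,5) up_set_def down_set_def atLeastAtMost_iff by (rule UN_least) auto
  qed
  moreover have "{a i..b i} \<inter> {a j..b j} = {}" if "i \<in> {1..m}" "j \<in> {1..m}" "i \<noteq> j" for i j
  proof -
    have False if "x \<in> {a i..b i}" "x \<in> {a j..b j}" for x
      using ab[of i x j] that \<open>i \<in> {1..m}\<close> \<open>j \<in> {1..m}\<close> \<open>i \<noteq> j\<close> by simp
    then show ?thesis by blast
  qed
  ultimately have "sum ?f (?U \<inter> down_set B) = (\<Sum>i = 1..m. sum ?f {a i..b i})"
    by (simp only:) (rule sum.UNION_disjoint, simp_all)
  also have "\<dots> = (\<Sum>i = 1..m. beta r (r (a i)) (r (b i)) - of_bool (r (a i) = 0))"
  proof (rule sum.cong[OF refl])
    fix i assume i: "i \<in> {1..m}"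
    have W: "weight r A x = card {y. covers x y \<and> \<not> a i \<le> y}" if "x \<in> {a i..b i}" for x
    proof -
      \<comment> \<open>An element covered by \<open>x\<close> is still below \<open>b i\<close>, so
        \<open>a i\<close> is the only member of \<open>A\<close> that can lie below it.\<close>
      have "y \<in> ?U \<longleftrightarrow> a i \<le> y" if "covers x y" for y
      proof
        assume "y \<in> ?U"
        then obtain j where j: "j \<in> {1..m}" "a j \<le> y" unfolding assms(4) up_set_def by blast
        moreover have "y \<le> b i"
          using \<open>x \<in> {a i..b i}\<close> that by (auto simp: covers_def)
        ultimately show "a i \<le> y" using ab i by blast
      qed (use i in \<open>auto simp: assms(4) up_set_def\<close>)
      then have "{y. covers x y \<and> y \<notin> ?U} = {y. covers x y \<and> \<not> a i \<le> y}" by blast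
      moreover have "x \<in> ?U" using that i by (auto simp: assms(4) up_set_def)
      ultimately show ?thesis by (simp add: weight_eq_card_covers[OF r])
    qed
    show "sum ?f {a i..b i} = beta r (r (a i)) (r (b i)) - of_bool (r (a i) = 0)"
      unfolding sum_interval_eq_beta[OF r sr le[OF i], symmetric]
      by (rule sum.cong) (simp_all add: W)
  qed
  also have "\<dots> = (\<Sum>i = 1..m. beta r (r (a i)) (r (b i))) - of_bool (bot \<in> ?U)"
  proof -
    have "(\<Sum>i = 1..m. of_bool (r (a i) = 0)) = (of_bool (bot \<in> ?U) :: real)"
    proof (cases "bot \<in> ?U")
      case True
      then obtain k where k: "k \<in> {1..m}" "a k = bot"
        by (auto simp: assms(4) up_set_def bot_unique)
      \<comment> \<open>Since \<open>bot\<close> lies below every \<open>b i\<close>, having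
        \<open>a k = bot\<close> forces every index to equal \<open>k\<close>, and the correction is
        counted exactly once.\<close>
      then have "r (a i) = 0 \<longleftrightarrow> i = k" if "i \<in> {1..m}" for i
        using ab[of k bot i] that by (auto simp: rank_eq_0_iff[OF r])
      then have "(\<Sum>i = 1..m. of_bool (r (a i) = 0)) = (\<Sum>i = 1..m. if i = k then 1 else (0 :: real))"
        by (intro sum.cong) auto
      then show ?thesis using True k(1) by simp
    next
      case False
      then show ?thesis by (auto simp: assms(4) up_set_def bot_unique rank_eq_0_iff[OF r])
    qed
    then show ?thesis by (simp add: sum_subtractf)
  qed
  finally have "sum ?f (?U \<inter> down_set B)
      = (\<Sum>i = 1..m. beta r (r (a i)) (r (b i))) - of_bool (bot \<in> ?U)" .
  moreover have "sum ?f ?U = sum ?f (?U \<inter> down_set B) + sum ?f (?U - down_set B)"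
    by (rule sum.Int_Diff) simp
  \<comment> \<open>The indicator of \<open>bot\<close> is subtracted both in the total flow and in
    the part inside \<open>down_set B\<close>, so it cancels.\<close>
  ultimately show ?thesis using total by simp
qed

end
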